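(* Let $A,B,C$ be $n\times n$ Hermitian positive definite matrices, and $t\in[0,1]$. Then $$\delta_S^2(A\sharp_t B,\;A\sharp_t C)\le t\,\delta_S^2(B,C).$$
   Context: For Hermitian positive definite $X,Y$: $\delta_S^2(X,Y):=\log\det\left(\frac{X+Y}{2}\right)-\frac12\log\det(XY)$, and for $t\in[0,1]$, $X\sharp_t Y:=X^{1/2}(X^{-1/2}YX^{-1/2})^tX^{1/2}$. *)

theory Defs
  imports "Jordan_Normal_Form.Schur_Decomposition"
begin

definition hpd_mat :: "nat \<Rightarrow> complex mat \<Rightarrow> bool" where
  "hpd_mat n A \<longleftrightarrow>
     A \<in> carrier_mat n n \<and> mat_adjoint A = A \<and>
     (\<forall>v \<in> carrier_vec n. v \<noteq> 0\<^sub>v n \<longrightarrow> 0 < Re ((A *\<^sub>v v) \<bullet>c v))"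

definition unitary_mat :: "nat \<Rightarrow> complex mat \<Rightarrow> bool" where
  "unitary_mat n U \<longleftrightarrow>
     U \<in> carrier_mat n n \<and> mat_adjoint U * U = 1\<^sub>m n \<and> U * mat_adjoint U = 1\<^sub>m n"

text \<open>
  Real powers by the spectral calculus: if \<open>X = U diag(d) U\<^sup>*\<close> with \<open>U\<close> unitary and all
  \<open>d i > 0\<close>, then \<open>X\<^sup>s = U diag(d\<^sup>s) U\<^sup>*\<close>. The result does not depend on the chosen
  diagonalization. The value is meaningful only for Hermitian positive definite \<open>X\<close>.
\<close>

definition mat_powr :: "complex mat \<Rightarrow> real \<Rightarrow> complex mat" where
  "mat_powr X s = (THE Y. \<exists>U d. unitary_mat (dim_row X) U \<and> (\<forall>i < dim_row X. 0 < d i) \<and>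
     X = U * mat_diag (dim_row X) (\<lambda>i. complex_of_real (d i)) * mat_adjoint U \<and>
     Y = U * mat_diag (dim_row X) (\<lambda>i. complex_of_real (d i powr s)) * mat_adjoint U)"

definition geo_mean :: "real \<Rightarrow> complex mat \<Rightarrow> complex mat \<Rightarrow> complex mat" where
  "geo_mean t X Y =
     mat_powr X (1/2) * mat_powr (mat_powr X (-1/2) * Y * mat_powr X (-1/2)) t * mat_powr X (1/2)"

text \<open>
  This is \<open>\<delta>\<^sub>S\<^sup>2\<close> itself, not its square root. For Hermitian positive definite arguments both
  determinants are positive reals, so taking real parts only changes the type.
\<close>

definition S_div_sq :: "complex mat \<Rightarrow> complex mat \<Rightarrow> real" where
  "S_div_sq X Y =
     ln (Re (det ((1/2) \<cdot>\<^sub>m (X + Y)))) - 1/2 * ln (Re (det (X * Y)))"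

end

theory Submission
  imports Defs "Jordan_Normal_Form.Spectral_Radius"
begin

text \<open>
  \<open>\<delta>\<^sub>S\<^sup>2\<close> is invariant under congruence, so taking \<open>A\<^sup>1\<^sup>/\<^sup>2\<close> out of both geometric means reduces the
  claim to \<open>det ((P\<^sup>t + Q\<^sup>t) / 2) \<le> det ((P + Q) / 2)\<^sup>t\<close>. Operator concavity of \<open>x\<^sup>t\<close> is not needed for
  this: in an eigenbasis of \<open>(P + Q) / 2\<close> with eigenvalues \<open>m\<^sub>i\<close>, Hadamard's inequality bounds the left
  side by the product of the diagonal entries of \<open>(P\<^sup>t + Q\<^sup>t) / 2\<close>, and the tangent line of \<open>x\<^sup>t\<close> at \<open>m\<^sub>i\<close>,
  averaged over the spectra of \<open>P\<close> and \<open>Q\<close>, bounds the \<open>i\<close>-th entry by \<open>m\<^sub>i\<^sup>t\<close>.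
\<close>


section \<open>Adjoints and unitary matrices\<close>

lemma mult_carrier_square_mat [simp]:
  "A \<in> carrier_mat n n \<Longrightarrow> B \<in> carrier_mat n n \<Longrightarrow> A * B \<in> carrier_mat n n"
  by (rule mult_carrier_mat)

lemma mult_mat_vec_square [simp]:
  "A \<in> carrier_mat n n \<Longrightarrow> v \<in> carrier_vec n \<Longrightarrow> A *\<^sub>v v \<in> carrier_vec n"
  by (rule mult_mat_vec_carrier)

lemma one_mult_square_mat [simp]:
  fixes A :: "'a :: semiring_1 mat"
  assumes "A \<in> carrier_mat n n"
  shows "1\<^sub>m n * A = A" "A * 1\<^sub>m n = A"
  by (rule left_mult_one_mat[OF assms] right_mult_one_mat[OF assms])+

lemma mat_adjoint_carrier [simp, intro]:
  "A \<in> carrier_mat n m \<Longrightarrow> mat_adjoint A \<in> carrier_mat m n"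
  by (auto simp: mat_adjoint_def mat_of_rows_def)

lemma dim_mat_adjoint [simp]:
  "dim_row (mat_adjoint A) = dim_col A" "dim_col (mat_adjoint A) = dim_row A"
  by (auto simp: mat_adjoint_def mat_of_rows_def)

lemma index_mat_adjoint [simp]:
  "i < dim_col A \<Longrightarrow> j < dim_row A \<Longrightarrow> mat_adjoint A $$ (i, j) = conjugate (A $$ (j, i))"
  by (simp add: mat_adjoint_def mat_of_rows_def)

lemma mat_adjoint_adjoint [simp]: "mat_adjoint (mat_adjoint A) = A"
  by (rule eq_matI) auto

lemma mat_adjoint_mult:
  fixes A B :: "complex mat"
  assumes "A \<in> carrier_mat n m" "B \<in> carrier_mat m k"
  shows "mat_adjoint (A * B) = mat_adjoint B * mat_adjoint A"
  using assms by (intro eq_matI) (auto simp: scalar_prod_def mult.commute intro!: sum.cong)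

lemma mat_adjoint_diag_real [simp]:
  "mat_adjoint (mat_diag n (\<lambda>i. complex_of_real (d i))) = mat_diag n (\<lambda>i. complex_of_real (d i))"
  by (rule eq_matI) (auto simp: mat_diag_def)

lemma mat_adjoint_add:
  fixes A B :: "complex mat"
  assumes "A \<in> carrier_mat n m" "B \<in> carrier_mat n m"
  shows "mat_adjoint (A + B) = mat_adjoint A + mat_adjoint B"
  using assms by (intro eq_matI) auto

lemma mat_adjoint_smult_real:
  "mat_adjoint (complex_of_real c \<cdot>\<^sub>m A) = complex_of_real c \<cdot>\<^sub>m mat_adjoint A"
  by (rule eq_matI) auto

lemma cscalar_prod_adjoint:
  fixes Z :: "complex mat"
  assumes "Z \<in> carrier_mat n m" "w \<in> carrier_vec n" "v \<in> carrier_vec m"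
  shows "(mat_adjoint Z *\<^sub>v w) \<bullet>c v = w \<bullet>c (Z *\<^sub>v v)"
proof -
  have "(mat_adjoint Z *\<^sub>v w) \<bullet>c v = (\<Sum>j<m. \<Sum>i<n. cnj (Z $$ (i, j)) * w $ i * cnj (v $ j))"
    using assms by (auto simp: scalar_prod_def sum_distrib_right lessThan_atLeast0 intro!: sum.cong)
  also have "\<dots> = (\<Sum>i<n. \<Sum>j<m. cnj (Z $$ (i, j)) * w $ i * cnj (v $ j))"
    by (rule sum.swap)
  also have "\<dots> = w \<bullet>c (Z *\<^sub>v v)"
    using assms by (auto simp: scalar_prod_def sum_distrib_left lessThan_atLeast0 algebra_simps intro!: sum.cong)
  finally show ?thesis .
qed

lemma unitary_mat_carrier [dest]: "unitary_mat n U \<Longrightarrow> U \<in> carrier_mat n n"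
  by (simp add: unitary_mat_def)

lemma unitary_mat_adjoint: "unitary_mat n U \<Longrightarrow> unitary_mat n (mat_adjoint U)"
  by (auto simp: unitary_mat_def)

text \<open>A one-sided inverse of a square matrix is two-sided.\<close>

lemma unitary_matI:
  assumes U: "U \<in> carrier_mat n n" and "mat_adjoint U * U = 1\<^sub>m n"
  shows "unitary_mat n U"
  using assms mat_mult_left_right_inverse[OF mat_adjoint_carrier[OF U] U]
  by (simp add: unitary_mat_def)

text \<open>Cancellation for right-nested products, the form that rewriting with associativity
  produces.\<close>

lemma unitary_cancel:
  assumes "unitary_mat n U" "M \<in> carrier_mat n k"
  shows "mat_adjoint U * (U * M) = M" "U * (mat_adjoint U * M) = M"
  using assms
    assoc_mult_mat[of "mat_adjoint U" n n U n M k]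
    assoc_mult_mat[of U n n "mat_adjoint U" n M k]
  by (auto simp: unitary_mat_def)

lemma unitary_mat_mult:
  assumes "unitary_mat n U" "unitary_mat n V"
  shows "unitary_mat n (U * V)"
proof (rule unitary_matI)
  have [simp]: "U \<in> carrier_mat n n" "V \<in> carrier_mat n n" using assms by auto
  show "U * V \<in> carrier_mat n n" by simp
  have "mat_adjoint (U * V) * (U * V) = mat_adjoint V * (mat_adjoint U * (U * V))"
    by (simp add: mat_adjoint_mult[of _ n n _ n] assoc_mult_mat[of _ n n _ n _ n])
  also have "\<dots> = 1\<^sub>m n"
    using assms by (simp add: unitary_cancel[of n U _ n]) (simp add: unitary_mat_def)
  finally show "mat_adjoint (U * V) * (U * V) = 1\<^sub>m n" .
qed

text \<open>Applied to \<open>mat_adjoint U\<close> in place of \<open>U\<close>, it recovers the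
  diagonal factor from a spectral decomposition.\<close>

lemma unitary_conj_swap:
  assumes U: "unitary_mat n U" and M: "M \<in> carrier_mat n n" and D: "D = mat_adjoint U * M * U"
  shows "M = U * D * mat_adjoint U"
proof -
  have [simp]: "U \<in> carrier_mat n n" using U by auto
  have "U * D * mat_adjoint U = U * (mat_adjoint U * (M * (U * mat_adjoint U)))"
    using M by (simp add: D assoc_mult_mat[of _ n n _ n _ n])
  also have "\<dots> = M"
    using U M by (simp add: unitary_cancel[of n U _ n]) (simp add: unitary_mat_def)
  finally show ?thesis ..
qed

section \<open>The spectral theorem for Hermitian matrices\<close>

text \<open>Supplies the deflating unitary of the spectral theorem. A basis starting with
  \<open>v\<close> is orthogonalized by Gram-Schmidt, which keeps its first vector, and the columns
  are then normalized.\<close>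

lemma unitary_first_col:
  fixes v :: "complex vec"
  assumes v: "v \<in> carrier_vec n" and v0: "v \<noteq> 0\<^sub>v n"
  obtains U c where "unitary_mat n U" "col U 0 = c \<cdot>\<^sub>v v"
proof -
  define b where "b = basis_completion v"
  define ws where "ws = gram_schmidt n b"
  define W where "W = mat_of_cols n ws"
  interpret cof_vec_space n "TYPE(complex)" .
  from basis_completion[OF v v0, folded b_def]
  have dist_b: "distinct b" and indep: "\<not> lin_dep (set b)" and b: "set b \<subseteq> carrier_vec n"
    and hdb: "hd b = v" and len_b: "length b = n" by auto
  have n: "n \<noteq> 0" using v v0 by (metis carrier_vecD eq_vecI index_zero_vec(2) not_less0)
  with hdb len_b obtain vs where bv: "b = v # vs" by (cases b) auto
  from gram_schmidt_result[OF b dist_b indep refl, folded ws_def]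
  have ws: "set ws \<subseteq> carrier_vec n" "corthogonal ws" "length ws = n"
    by (auto simp: len_b)
  have hdws: "hd ws = v" using gram_schmidt_hd[OF v, of vs, folded bv] by (simp add: ws_def)
  have W: "W \<in> carrier_mat n n" using ws by (auto simp: W_def)
  have colW: "col W i = ws ! i" if "i < n" for i
    using that ws by (simp add: W_def subset_iff)
  \<comment> \<open>\<open>r i\<close> is the norm of column \<open>i\<close>. Gram-Schmidt here
    only orthogonalizes, so \<open>U\<close> below divides column \<open>i\<close> of
    \<open>W\<close> by \<open>r i\<close>.\<close>
  define r where "r i = sqrt (Re (col W i \<bullet>c col W i))" for i
  have orth: "col W i \<bullet>c col W j = 0 \<longleftrightarrow> i \<noteq> j" if "i < n" "j < n" for i j
    using that ws colW by (simp add: corthogonal_def)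
  have self: "col W i \<bullet>c col W i = complex_of_real (r i ^ 2)" "r i \<noteq> 0" if "i < n" for i
  proof -
    have "col W i \<bullet>c col W i \<ge> 0" by (rule conjugate_square_ge_0_vec)
    moreover have "col W i \<bullet>c col W i \<noteq> 0" using orth[of i i] that by simp
    ultimately have "Re (col W i \<bullet>c col W i) > 0" "Im (col W i \<bullet>c col W i) = 0"
      by (auto simp: less_eq_complex_def complex_eq_iff less_le)
    thus "col W i \<bullet>c col W i = complex_of_real (r i ^ 2)" "r i \<noteq> 0"
      by (auto simp: r_def complex_eq_iff)
  qed
  define U where "U = W * mat_diag n (\<lambda>i. complex_of_real (1 / r i))"
  have U: "U \<in> carrier_mat n n" using W by (simp add: U_def)
  have Uij: "U $$ (i, j) = W $$ (i, j) / r j" if "i < n" "j < n" for i j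
    using that W by (simp add: U_def mat_diag_mult_right[OF W])
  have "mat_adjoint U * U = 1\<^sub>m n"
  proof (rule eq_matI)
    fix i j assume "i < dim_row (1\<^sub>m n :: complex mat)" "j < dim_col (1\<^sub>m n :: complex mat)"
    hence ij: "i < n" "j < n" by auto
    have "(mat_adjoint U * U) $$ (i, j) = (\<Sum>k<n. cnj (U $$ (k, i)) * U $$ (k, j))"
      using ij U by (simp add: scalar_prod_def lessThan_atLeast0)
    also have "\<dots> = (\<Sum>k<n. W $$ (k, j) * cnj (W $$ (k, i))) / (r i * r j)"
      unfolding sum_divide_distrib using ij by (intro sum.cong) (auto simp: Uij)
    also have "(\<Sum>k<n. W $$ (k, j) * cnj (W $$ (k, i))) = col W j \<bullet>c col W i"
      using ij W by (simp add: scalar_prod_def lessThan_atLeast0)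
    also have "(col W j \<bullet>c col W i) / (r i * r j) = 1\<^sub>m n $$ (i, j)"
      using ij self[of i] orth[of j i] by (auto simp: power2_eq_square)
    finally show "(mat_adjoint U * U) $$ (i, j) = 1\<^sub>m n $$ (i, j)" .
  qed (use U in auto)
  hence "unitary_mat n U" using U by (rule unitary_matI[rotated])
  moreover have "col U 0 = (1 / r 0) \<cdot>\<^sub>v v"
  proof (rule eq_vecI)
    have W0: "col W 0 = v" using colW[of 0] n hdws ws by (cases ws) auto
    show "col U 0 $ i = ((1 / r 0) \<cdot>\<^sub>v v) $ i" if "i < dim_vec ((1 / r 0) \<cdot>\<^sub>v v)" for i
      using that v n U W Uij W0[THEN arg_cong, of "\<lambda>v. v $ i"] by auto
  qed (use U v in auto)
  ultimately show ?thesis by (rule that)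
qed

text \<open>Induction by deflation: in an orthonormal basis whose first vector is an eigenvector,
  the first column vanishes below the corner. Hermitian symmetry clears the first row as well, and
  the remaining block is Hermitian of size \<open>n\<close>.\<close>

theorem hermitian_spectral:
  fixes A :: "complex mat"
  assumes "A \<in> carrier_mat n n" "mat_adjoint A = A"
  shows "\<exists>U d. unitary_mat n U \<and>
    A = U * mat_diag n (\<lambda>i. complex_of_real (d i)) * mat_adjoint U"
  using assms
proof (induction n arbitrary: A)
  case 0
  thus ?case
    by (intro exI[of _ "1\<^sub>m 0"] exI[of _ "\<lambda>_. 0"]) (auto simp: unitary_mat_def mat_diag_def intro!: eq_matI)
next
  case (Suc n)
  note A = Suc.prems(1) and herm = Suc.prems(2)
  obtain e where "eigenvalue A e"
    using spectrum_non_empty[OF A] by (auto simp: spectrum_def)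
  then obtain v where v: "v \<in> carrier_vec (Suc n)" "v \<noteq> 0\<^sub>v (Suc n)" and ev: "A *\<^sub>v v = e \<cdot>\<^sub>v v"
    using A by (auto simp: eigenvalue_def eigenvector_def)
  obtain U c where U: "unitary_mat (Suc n) U" and col0: "col U 0 = c \<cdot>\<^sub>v v"
    using unitary_first_col[OF v] by metis
  have Uc [simp]: "U \<in> carrier_mat (Suc n) (Suc n)" using U by auto
  note assoc = assoc_mult_mat[of _ "Suc n" "Suc n" _ "Suc n" _ "Suc n"]
  define H where "H = mat_adjoint U * A * U"
  have H [simp]: "H \<in> carrier_mat (Suc n) (Suc n)" using A by (simp add: H_def)
  have hermH: "mat_adjoint H = H"
    using A herm by (simp add: H_def mat_adjoint_mult[of _ "Suc n" "Suc n" _ "Suc n"] assoc)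
  have AU: "A *\<^sub>v col U 0 = e \<cdot>\<^sub>v col U 0"
    using A v ev col0 by (simp add: mult_mat_vec smult_smult_assoc mult.commute)
  \<comment> \<open>Column 0 of \<open>H\<close> is \<open>mat_adjoint U\<close> applied to
    \<open>A *\<^sub>v col U 0\<close>, hence \<open>e\<close> times column 0 of the
    identity.\<close>
  have Hi0: "H $$ (i, 0) = (if i = 0 then e else 0)" if "i < Suc n" for i
  proof -
    have "H $$ (i, 0) = (mat_adjoint U * (A * U)) $$ (i, 0)" using A by (simp add: H_def assoc)
    also have "\<dots> = row (mat_adjoint U) i \<bullet> (A *\<^sub>v col U 0)"
      using that A Uc by (subst index_mult_mat) (auto simp: col_mult2[OF A Uc] carrier_matD[OF Uc])
    also have "\<dots> = e * (row (mat_adjoint U) i \<bullet> col U 0)"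
      unfolding AU using that by (intro scalar_prod_smult_distrib[of _ "Suc n"]) (auto intro!: carrier_vecI simp: carrier_matD[OF Uc])
    also have "row (mat_adjoint U) i \<bullet> col U 0 = (mat_adjoint U * U) $$ (i, 0)"
      using that carrier_matD[OF Uc] by simp
    also have "mat_adjoint U * U = 1\<^sub>m (Suc n)" using U by (simp add: unitary_mat_def)
    finally show ?thesis using that by simp
  qed
  have H0i: "H $$ (0, i) = (if i = 0 then cnj e else 0)" if "i < Suc n" for i
    using arg_cong[OF hermH, of "\<lambda>M. M $$ (0, i)"] that Hi0[OF that] carrier_matD[OF H] by auto
  define r where "r = Re e"
  \<comment> \<open>The corner entry is \<open>e\<close> when read from the first column and
    \<open>cnj e\<close> when read from the first row, so the eigenvalue is real.\<close>
  have e: "e = complex_of_real r"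
    using Hi0[of 0] H0i[of 0] by (simp add: complex_eq_iff r_def)
  define K where "K = mat n n (\<lambda>(i, j). H $$ (Suc i, Suc j))"
  have K [simp]: "K \<in> carrier_mat n n" by (simp add: K_def)
  have "mat_adjoint K = K"
  proof (rule eq_matI)
    fix i j assume "i < dim_row K" "j < dim_col K"
    thus "mat_adjoint K $$ (i, j) = K $$ (i, j)"
      using arg_cong[OF hermH, of "\<lambda>M. M $$ (Suc i, Suc j)"] carrier_matD[OF H]
      by (auto simp: K_def)
  qed (auto simp: K_def)
  from Suc.IH[OF K this] obtain V d where V: "unitary_mat n V"
    and KV: "K = V * mat_diag n (\<lambda>i. complex_of_real (d i)) * mat_adjoint V" by auto
  have Vc [simp]: "V \<in> carrier_mat n n" using V by auto
  \<comment> \<open>Block diagonal matrices with a scalar corner multiply and take adjoints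
    blockwise. Bordering \<open>V\<close> with a corner 1 therefore lifts the diagonalization of
    \<open>K\<close> to one of \<open>H\<close>.\<close>
  let ?blk = "\<lambda>x M. four_block_mat (mat_diag 1 (\<lambda>_. x)) (0\<^sub>m 1 n) (0\<^sub>m n 1) (M :: complex mat)"
  have blk_mult: "?blk x M * ?blk y N = ?blk (x * y) (M * N)"
    if "M \<in> carrier_mat n n" "N \<in> carrier_mat n n" for x y M N
    using that by (subst mult_four_block_mat[of _ 1 1 _ n _ n])
      (auto simp: right_mult_zero_mat[OF mat_diag_dim] left_mult_zero_mat[OF mat_diag_dim])
  have blk_adj: "mat_adjoint (?blk x M) = ?blk (cnj x) (mat_adjoint M)"
    if "M \<in> carrier_mat n n" for x M
    using that by (intro eq_matI) (auto simp: mat_diag_def)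
  define d' where "d' i = (case i of 0 \<Rightarrow> r | Suc k \<Rightarrow> d k)" for i
  have "cnj e = e" by (simp add: e)
  hence HK: "H = ?blk e K"
    using carrier_matD[OF H] by (intro eq_matI) (auto simp: K_def mat_diag_def Hi0 H0i)
  have diag: "mat_diag (Suc n) (\<lambda>i. complex_of_real (d' i))
      = ?blk e (mat_diag n (\<lambda>i. complex_of_real (d i)))"
    using e by (intro eq_matI) (auto simp: mat_diag_def d'_def split: nat.splits)
  define W where "W = ?blk 1 V"
  have W [simp]: "W \<in> carrier_mat (Suc n) (Suc n)"
    unfolding W_def using four_block_carrier_mat[of "mat_diag 1 (\<lambda>_. 1)" 1 1 V n n] by simp
  have WU: "unitary_mat (Suc n) W"
  proof (rule unitary_matI)
    have "mat_adjoint W * W = ?blk (cnj 1 * 1) (mat_adjoint V * V)"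
      unfolding W_def by (simp only: blk_adj[OF Vc] blk_mult[OF mat_adjoint_carrier[OF Vc] Vc])
    also have "\<dots> = 1\<^sub>m (Suc n)"
      using V four_block_one_mat[of 1 n] by (simp add: unitary_mat_def)
    finally show "mat_adjoint W * W = 1\<^sub>m (Suc n)" .
  qed simp
  let ?D = "mat_diag (Suc n) (\<lambda>i. complex_of_real (d' i))"
  have "H = W * ?D * mat_adjoint W"
    unfolding HK diag W_def KV
    by (simp only: blk_adj[OF Vc] blk_mult Vc mat_adjoint_carrier mat_diag_dim mult_carrier_square_mat
        complex_cnj_one mult_1_left mult_1_right)
  moreover have "A = U * H * mat_adjoint U"
    using unitary_conj_swap[OF U A H_def] .
  ultimately have "A = (U * W) * ?D * mat_adjoint (U * W)"
    by (simp add: mat_adjoint_mult[of _ "Suc n" "Suc n" _ "Suc n"] assoc)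
  thus ?case using unitary_mat_mult[OF U WU] by blast
qed


section \<open>Hermitian positive definite matrices\<close>

lemma hpd_mat_carrier [dest]: "hpd_mat n A \<Longrightarrow> A \<in> carrier_mat n n"
  by (simp add: hpd_mat_def)

lemma hpd_mat_add:
  assumes "hpd_mat n A" "hpd_mat n B"
  shows "hpd_mat n (A + B)"
proof -
  have [simp]: "A \<in> carrier_mat n n" "B \<in> carrier_mat n n" using assms by auto
  have "((A + B) *\<^sub>v v) \<bullet>c v = (A *\<^sub>v v) \<bullet>c v + (B *\<^sub>v v) \<bullet>c v"
    if "v \<in> carrier_vec n" for v
    using that by (simp add: add_mult_distrib_mat_vec[of _ n n] add_scalar_prod_distrib[of _ n])
  thus ?thesis
    using assms by (auto simp: hpd_mat_def mat_adjoint_add[of _ n n] intro!: add_pos_pos)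
qed

lemma hpd_mat_smult:
  assumes "hpd_mat n A" "0 < c"
  shows "hpd_mat n (complex_of_real c \<cdot>\<^sub>m A)"
proof -
  have Ac [simp]: "A \<in> carrier_mat n n" using assms by auto
  have "((complex_of_real c \<cdot>\<^sub>m A) *\<^sub>v v) \<bullet>c v = complex_of_real c * ((A *\<^sub>v v) \<bullet>c v)"
    if "v \<in> carrier_vec n" for v
  proof -
    have "(complex_of_real c \<cdot>\<^sub>m A) *\<^sub>v v = complex_of_real c \<cdot>\<^sub>v (A *\<^sub>v v)"
      using that carrier_matD[OF Ac] by (intro eq_vecI) (auto simp: scalar_prod_def sum_distrib_left mult.assoc intro!: sum.cong)
    thus ?thesis using that by (simp add: smult_scalar_prod_distrib[of _ n])
  qed
  thus ?thesis
    using assms by (auto simp: hpd_mat_def mat_adjoint_smult_real)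
qed

lemma hpd_mat_half_add:
  assumes "hpd_mat n A" "hpd_mat n B"
  shows "hpd_mat n ((1/2) \<cdot>\<^sub>m (A + B))"
  using hpd_mat_smult[OF hpd_mat_add[OF assms], of "1/2"] by simp

text \<open>The form of the new matrix at \<open>v\<close> is the form of \<open>N\<close> at
  \<open>Z *\<^sub>v v\<close>. The left inverse \<open>W\<close> makes \<open>Z\<close> injective,
  so this vector is nonzero whenever \<open>v\<close> is.\<close>

lemma hpd_mat_congruence:
  assumes N: "hpd_mat n N" and Z: "Z \<in> carrier_mat n n" and W: "W \<in> carrier_mat n n"
    and WZ: "W * Z = 1\<^sub>m n"
  shows "hpd_mat n (mat_adjoint Z * N * Z)"
  unfolding hpd_mat_def
proof (intro conjI ballI impI)
  have [simp]: "N \<in> carrier_mat n n" using N by auto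
  note [simp] = Z
  show "mat_adjoint Z * N * Z \<in> carrier_mat n n" by simp
  show "mat_adjoint (mat_adjoint Z * N * Z) = mat_adjoint Z * N * Z"
    using N by (simp add: hpd_mat_def mat_adjoint_mult[of _ n n _ n] assoc_mult_mat[of _ n n _ n _ n])
  fix v :: "complex vec" assume v: "v \<in> carrier_vec n" "v \<noteq> 0\<^sub>v n"
  have Zv: "Z *\<^sub>v v \<in> carrier_vec n" using v by simp
  have "W *\<^sub>v (Z *\<^sub>v v) = v"
    using assoc_mult_mat_vec[OF W Z v(1)] WZ v by simp
  moreover have "W *\<^sub>v 0\<^sub>v n = 0\<^sub>v n" using W by (intro eq_vecI) auto
  ultimately have "Z *\<^sub>v v \<noteq> 0\<^sub>v n" using v by metis
  hence "0 < Re ((N *\<^sub>v (Z *\<^sub>v v)) \<bullet>c (Z *\<^sub>v v))" using N Zv by (simp add: hpd_mat_def)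
  also have "(N *\<^sub>v (Z *\<^sub>v v)) \<bullet>c (Z *\<^sub>v v) = (mat_adjoint Z *\<^sub>v (N *\<^sub>v (Z *\<^sub>v v))) \<bullet>c v"
    using v Zv by (subst cscalar_prod_adjoint[OF Z]) auto
  also have "mat_adjoint Z *\<^sub>v (N *\<^sub>v (Z *\<^sub>v v)) = mat_adjoint Z * N * Z *\<^sub>v v"
    using v Zv by (simp add: assoc_mult_mat_vec[of _ n n _ n])
  finally show "0 < Re ((mat_adjoint Z * N * Z *\<^sub>v v) \<bullet>c v)" .
qed

lemma hpd_mat_diag_pos:
  assumes "hpd_mat n A" "i < n"
  shows "0 < Re (A $$ (i, i))"
proof -
  have A: "A \<in> carrier_mat n n" using assms by auto
  have "unit_vec n i \<noteq> (0\<^sub>v n :: complex vec)"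
    using assms(2) by (metis index_unit_vec(1) index_zero_vec(1) zero_neq_one)
  hence "0 < Re ((A *\<^sub>v unit_vec n i) \<bullet>c unit_vec n i)"
    using assms by (simp add: hpd_mat_def)
  also have "conjugate (unit_vec n i) = (unit_vec n i :: complex vec)"
    by (intro eq_vecI) (auto simp: unit_vec_def)
  also have "(A *\<^sub>v unit_vec n i) \<bullet> unit_vec n i = A $$ (i, i)"
    using A assms(2) by (simp add: mult_mat_vec_def)
  finally show ?thesis .
qed

lemma hpd_mat_diag:
  assumes "\<And>i. i < n \<Longrightarrow> 0 < d i"
  shows "hpd_mat n (mat_diag n (\<lambda>i. complex_of_real (d i)))"
  unfolding hpd_mat_def
proof (intro conjI ballI impI)
  fix v :: "complex vec" assume v: "v \<in> carrier_vec n" "v \<noteq> 0\<^sub>v n"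
  then obtain k where k: "k < n" "v $ k \<noteq> 0"
    by (metis carrier_vecD eq_vecI index_zero_vec)
  have "(mat_diag n (\<lambda>i. complex_of_real (d i)) *\<^sub>v v) $ i = d i * v $ i" if "i < n" for i
  proof -
    have "(mat_diag n (\<lambda>i. complex_of_real (d i)) *\<^sub>v v) $ i
        = (\<Sum>j<n. if i = j then d j * v $ j else 0)"
      using that v by (simp add: mat_diag_def scalar_prod_def lessThan_atLeast0 if_distrib[of "\<lambda>x. x * _"] cong: if_cong)
    thus ?thesis using that by simp
  qed
  hence "Re ((mat_diag n (\<lambda>i. complex_of_real (d i)) *\<^sub>v v) \<bullet>c v)
      = (\<Sum>i<n. d i * (cmod (v $ i))\<^sup>2)"
    using v unfolding cmod_power2
    by (auto simp: scalar_prod_def lessThan_atLeast0 algebra_simps power2_eq_square intro!: sum.cong)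
  also have "\<dots> > 0"
    using assms k by (intro sum_pos2[of _ k]) (auto simp: less_imp_le)
  finally show "0 < Re ((mat_diag n (\<lambda>i. complex_of_real (d i)) *\<^sub>v v) \<bullet>c v)" .
qed auto

lemma hpd_mat_of_spectral:
  assumes U: "unitary_mat n U" and "\<And>i. i < n \<Longrightarrow> 0 < d i"
  shows "hpd_mat n (U * mat_diag n (\<lambda>i. complex_of_real (d i)) * mat_adjoint U)"
  using hpd_mat_congruence[OF hpd_mat_diag, of n d "mat_adjoint U" U] assms
  by (auto simp: unitary_mat_def)

text \<open>The diagonal factor is congruent to \<open>A\<close>, hence positive definite itself,
  and the eigenvalues are its diagonal entries.\<close>

lemma hpd_mat_spectral:
  assumes "hpd_mat n A"
  obtains U d where "unitary_mat n U" "\<And>i. i < n \<Longrightarrow> 0 < d i"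
    "A = U * mat_diag n (\<lambda>i. complex_of_real (d i)) * mat_adjoint U"
proof -
  obtain U d where U: "unitary_mat n U"
    and A: "A = U * mat_diag n (\<lambda>i. complex_of_real (d i)) * mat_adjoint U"
    using hermitian_spectral[of A n] assms by (auto simp: hpd_mat_def)
  have [simp]: "U \<in> carrier_mat n n" using U by auto
  have "mat_adjoint U * A * U = mat_diag n (\<lambda>i. complex_of_real (d i))"
    using unitary_conj_swap[OF unitary_mat_adjoint[OF U] _ , of "mat_diag n (\<lambda>i. complex_of_real (d i))" A] A
    by simp
  hence "hpd_mat n (mat_diag n (\<lambda>i. complex_of_real (d i)))"
    using hpd_mat_congruence[OF assms, of U "mat_adjoint U"] U by (simp add: unitary_mat_def)
  from hpd_mat_diag_pos[OF this] have "0 < d i" if "i < n" for i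
    using that by (fastforce simp: mat_diag_def)
  thus ?thesis using that U A by blast
qed

section \<open>Determinants of positive definite matrices\<close>

lemma det_mat_diag: "det (mat_diag n f) = (\<Prod>i<n. f i :: complex)"
  by (subst det_upper_triangular[of _ n])
    (auto simp: mat_diag_def upper_triangular_def prod_list_diag_prod lessThan_atLeast0)

lemma det_unitary_conj:
  assumes "unitary_mat n U" "M \<in> carrier_mat n n"
  shows "det (U * M * mat_adjoint U) = det M" "det (mat_adjoint U * M * U) = det M"
proof -
  have [simp]: "U \<in> carrier_mat n n" using assms by auto
  have "det U * det (mat_adjoint U) = det (U * mat_adjoint U)"
    by (rule det_mult[of _ n, symmetric]) auto
  also have "\<dots> = 1" using assms by (simp add: unitary_mat_def)
  finally have 1: "det U * det (mat_adjoint U) = 1" .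
  hence "det (mat_adjoint U) * det U = 1" by (simp only: mult.commute)
  with 1 show "det (U * M * mat_adjoint U) = det M" "det (mat_adjoint U * M * U) = det M"
    using assms(2) by (simp_all add: det_mult[of _ n])
qed

lemma det_spectral:
  assumes "unitary_mat n U"
  shows "det (U * mat_diag n (\<lambda>i. complex_of_real (d i)) * mat_adjoint U)
    = complex_of_real (\<Prod>i<n. d i)"
  using assms by (simp add: det_unitary_conj det_mat_diag)

text \<open>The determinant is the product of the positive eigenvalues. Being real, it loses nothing
  under the \<open>Re\<close> in \<open>S_div_sq\<close>.\<close>

lemma det_hpd_mat:
  assumes "hpd_mat n A"
  shows "0 < Re (det A)" "det A = complex_of_real (Re (det A))"
proof -
  obtain U d where "unitary_mat n U" and d: "\<And>i. i < n \<Longrightarrow> 0 < d i"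
    and A: "A = U * mat_diag n (\<lambda>i. complex_of_real (d i)) * mat_adjoint U"
    using hpd_mat_spectral[OF assms] by metis
  have "det A = complex_of_real (\<Prod>i<n. d i)" unfolding A by (rule det_spectral) fact
  moreover have "(\<Prod>i<n. d i) > 0" using d by (intro prod_pos) auto
  ultimately show "0 < Re (det A)" "det A = complex_of_real (Re (det A))" by (simp_all del: of_real_prod)
qed

lemma Re_det_mult:
  assumes "hpd_mat n A" "hpd_mat n B"
  shows "Re (det (A * B)) = Re (det A) * Re (det B)"
  using det_mult[of A n B] assms det_hpd_mat[OF assms(1)] det_hpd_mat[OF assms(2)]
  by (metis Re_complex_of_real hpd_mat_carrier of_real_mult)

section \<open>Real powers by the spectral calculus\<close>

text \<open>The \<open>THE\<close> in \<open>mat_powr\<close> requires that any two diagonalizations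
  of one matrix give the same power. The unitary relating two eigenbases intertwines the diagonal
  factors, and therefore also their powers.\<close>

lemma mat_powr_spectral:
  assumes U: "unitary_mat n U" and d: "\<And>i. i < n \<Longrightarrow> 0 < d i"
  shows "mat_powr (U * mat_diag n (\<lambda>i. complex_of_real (d i)) * mat_adjoint U) s
    = U * mat_diag n (\<lambda>i. complex_of_real (d i powr s)) * mat_adjoint U"
proof -
  let ?D = "\<lambda>d. mat_diag n (\<lambda>i. complex_of_real (d i))"
  have [simp]: "U \<in> carrier_mat n n" using U by auto
  note assoc = assoc_mult_mat[of _ n n _ n _ n]
  show ?thesis
    unfolding mat_powr_def
  proof (rule the_equality, goal_cases)
    case 1
    show ?case using assms carrier_matD(1)[of U n n]
      by (intro exI[of _ U] exI[of _ d]) simp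
  next
    case (2 Y)
    have dim: "dim_row (U * ?D d * mat_adjoint U) = n"
      using carrier_matD(1)[of U n n] by simp
    from 2 obtain V e where V: "unitary_mat n V" and e: "\<And>i. i < n \<Longrightarrow> 0 < e i"
      and eq: "U * ?D d * mat_adjoint U = V * ?D e * mat_adjoint V"
      and Y: "Y = V * ?D (\<lambda>i. e i powr s) * mat_adjoint V"
      unfolding dim by auto
    have [simp]: "V \<in> carrier_mat n n" using V by auto
    \<comment> \<open>\<open>W\<close> is the change of basis between the two eigenbases. The
      equality of the two decompositions becomes a commutation relation that can be compared
      entrywise.\<close>
    define W where "W = mat_adjoint V * U"
    have W [simp]: "W \<in> carrier_mat n n" by (simp add: W_def)
    have "W * ?D d = mat_adjoint V * (U * ?D d * mat_adjoint U) * U"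
      using U by (simp add: W_def assoc) (simp add: unitary_mat_def)
    also have "\<dots> = ?D e * W"
      unfolding eq using V by (simp add: W_def assoc unitary_cancel[of n V _ n])
    finally have comm: "W * ?D d = ?D e * W" .
    have *: "W $$ (i, j) * d j = e i * W $$ (i, j)" if "i < n" "j < n" for i j
    proof -
      have "(W * ?D d) $$ (i, j) = (?D e * W) $$ (i, j)" by (simp only: comm)
      thus ?thesis using that unfolding mat_diag_mult_left[OF W] mat_diag_mult_right[OF W] by simp
    qed
    \<comment> \<open>A nonzero entry \<open>W $$ (i, j)\<close> can be cancelled in
      \<open>*\<close>, forcing \<open>d j = e i\<close>; a zero entry makes both sides
      vanish.\<close>
    have "W $$ (i, j) * (d j powr s) = e i powr s * W $$ (i, j)" if "i < n" "j < n" for i j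
      using *[OF that] by (cases "W $$ (i, j) = 0") auto
    hence "W * ?D (\<lambda>i. d i powr s) = ?D (\<lambda>i. e i powr s) * W"
      by (auto simp: mat_diag_mult_left[OF W] mat_diag_mult_right[OF W] intro!: eq_matI)
    hence "V * (W * ?D (\<lambda>i. d i powr s)) * mat_adjoint U
        = V * (?D (\<lambda>i. e i powr s) * W) * mat_adjoint U" by simp
    moreover have "V * (W * ?D (\<lambda>i. d i powr s)) * mat_adjoint U
        = U * ?D (\<lambda>i. d i powr s) * mat_adjoint U"
      using V by (simp add: W_def assoc unitary_cancel[of n V _ n])
    moreover have "V * (?D (\<lambda>i. e i powr s) * W) * mat_adjoint U = Y"
      using U by (simp add: W_def Y assoc) (simp add: unitary_mat_def)
    ultimately show ?case by simp
  qed
qed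

text \<open>All four facts are read off one diagonalization of \<open>A\<close>; exponents add
  because the inner unitary factors cancel.\<close>

lemma
  assumes "hpd_mat n A"
  shows hpd_mat_powr: "hpd_mat n (mat_powr A s)"
    and Re_det_mat_powr: "Re (det (mat_powr A s)) = Re (det A) powr s"
    and mat_powr_mult: "mat_powr A r * mat_powr A s = mat_powr A (r + s)"
    and mat_powr_zero: "mat_powr A 0 = 1\<^sub>m n"
proof -
  obtain U d where U: "unitary_mat n U" and d: "\<And>i. i < n \<Longrightarrow> 0 < d i"
    and A: "A = U * mat_diag n (\<lambda>i. complex_of_real (d i)) * mat_adjoint U"
    using hpd_mat_spectral[OF assms] by metis
  have [simp]: "U \<in> carrier_mat n n" using U by auto
  have powr: "mat_powr A s = U * mat_diag n (\<lambda>i. complex_of_real (d i powr s)) * mat_adjoint U" for s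
    unfolding A by (rule mat_powr_spectral[OF U d])
  have "0 < d i powr s" if "i < n" for i using d[OF that] by simp
  thus "hpd_mat n (mat_powr A s)"
    unfolding powr by (intro hpd_mat_of_spectral U)
  show "Re (det (mat_powr A s)) = Re (det A) powr s"
    unfolding powr unfolding A det_spectral[OF U] by (simp add: prod_powr_distrib d less_imp_le del: of_real_prod)
  \<comment> \<open>Since \<open>0 powr 0 = 0\<close>, this relies on the eigenvalues being
    nonzero.\<close>
  have "mat_diag n (\<lambda>i. complex_of_real (d i powr 0)) = mat_diag n (\<lambda>i. 1)"
    using d by (auto simp: mat_diag_def less_imp_neq[symmetric])
  thus "mat_powr A 0 = 1\<^sub>m n"
    unfolding powr using U by (auto simp: unitary_mat_def)
  show "mat_powr A r * mat_powr A s = mat_powr A (r + s)"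
    unfolding powr using U
    by (simp add: assoc_mult_mat[of _ n n _ n _ n] unitary_cancel[of n U _ n])
      (simp add: assoc_mult_mat[of _ n n _ n _ n, symmetric] powr_add)
qed

section \<open>Diagonal entries and Hadamard's inequality\<close>

text \<open>Exhibits a diagonal entry as an average of the eigenvalues \<open>f j\<close>: by
  \<open>unitary_row_sum\<close> the weights add up to 1.\<close>

lemma unitary_diag_entry:
  assumes U: "unitary_mat n U" and i: "i < n"
  shows "Re ((U * mat_diag n (\<lambda>j. complex_of_real (f j)) * mat_adjoint U) $$ (i, i))
    = (\<Sum>j<n. (cmod (U $$ (i, j)))\<^sup>2 * f j)"
proof -
  have Uc: "U \<in> carrier_mat n n" using U by auto
  have "(U * mat_diag n (\<lambda>j. complex_of_real (f j)) * mat_adjoint U) $$ (i, i)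
      = (\<Sum>j<n. U $$ (i, j) * f j * cnj (U $$ (i, j)))"
    using Uc i by (simp add: mat_diag_mult_right[OF Uc] scalar_prod_def lessThan_atLeast0)
  also have "\<dots> = (\<Sum>j<n. complex_of_real ((cmod (U $$ (i, j)))\<^sup>2 * f j))"
    by (intro sum.cong refl, subst of_real_mult, subst complex_norm_square) simp
  finally show ?thesis by simp
qed

text \<open>The case of constant \<open>f = 1\<close> in \<open>unitary_diag_entry\<close>, where
  the conjugated matrix is the identity.\<close>

lemma unitary_row_sum:
  assumes U: "unitary_mat n U" and i: "i < n"
  shows "(\<Sum>j<n. (cmod (U $$ (i, j)))\<^sup>2) = 1"
  using unitary_diag_entry[OF assms, of "\<lambda>_. 1"] U i
  by (auto simp: unitary_mat_def)

lemma unitary_col_sum: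
  assumes U: "unitary_mat n U" and j: "j < n"
  shows "(\<Sum>i<n. (cmod (U $$ (i, j)))\<^sup>2) = 1"
  using unitary_row_sum[OF unitary_mat_adjoint[OF U] j] U j
  by (auto dest!: unitary_mat_carrier)

text \<open>Hadamard's inequality in normalized form. Summing \<open>ln x \<le> x - 1\<close> over
  the eigenvalues bounds the logarithm of the determinant by the trace minus \<open>n\<close>, which
  is at most 0.\<close>

lemma det_hpd_mat_le_one:
  assumes K: "hpd_mat n K" and le: "\<And>i. i < n \<Longrightarrow> Re (K $$ (i, i)) \<le> 1"
  shows "Re (det K) \<le> 1"
proof -
  obtain U d where U: "unitary_mat n U" and d: "\<And>i. i < n \<Longrightarrow> 0 < d i"
    and KU: "K = U * mat_diag n (\<lambda>i. complex_of_real (d i)) * mat_adjoint U"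
    using hpd_mat_spectral[OF K] by metis
  \<comment> \<open>The column sums insert the weights; exchanging the two sums then turns the sum
    of the eigenvalues into the trace.\<close>
  have "(\<Sum>j<n. d j) = (\<Sum>j<n. \<Sum>i<n. (cmod (U $$ (i, j)))\<^sup>2 * d j)"
    unfolding sum_distrib_right[symmetric] by (simp add: unitary_col_sum[OF U])
  also have "\<dots> = (\<Sum>i<n. Re (K $$ (i, i)))"
    unfolding KU by (subst sum.swap) (simp add: unitary_diag_entry[OF U])
  also have "\<dots> \<le> (\<Sum>i<n. 1)" using le by (intro sum_mono) auto
  finally have tr: "(\<Sum>j<n. d j - 1) \<le> 0" by (simp add: sum_subtractf)
  have "ln (\<Prod>j<n. d j) = (\<Sum>j<n. ln (d j))"
    using d by (intro ln_prod) (auto simp: less_imp_neq[symmetric] dest: less_imp_neq)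
  also have "\<dots> \<le> (\<Sum>j<n. d j - 1)"
    using d by (intro sum_mono ln_le_minus_one) auto
  finally have "ln (\<Prod>j<n. d j) \<le> 0" using tr by simp
  moreover have "(\<Prod>j<n. d j) > 0" using d by (intro prod_pos) auto
  ultimately have "(\<Prod>j<n. d j) \<le> 1" by simp
  thus ?thesis unfolding KU det_spectral[OF U] by (simp del: of_real_prod)
qed

text \<open>Scaling row and column \<open>i\<close> by \<open>1 / sqrt (g i)\<close> brings every
  diagonal entry down to at most 1 and divides the determinant by the product of the
  \<open>g i\<close>, which reduces to \<open>det_hpd_mat_le_one\<close>.\<close>

lemma hadamard_hpd_mat:
  assumes N: "hpd_mat n N" and g: "\<And>i. i < n \<Longrightarrow> 0 < g i"
    and le: "\<And>i. i < n \<Longrightarrow> Re (N $$ (i, i)) \<le> g i"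
  shows "Re (det N) \<le> (\<Prod>i<n. g i)"
proof -
  have Nc [simp]: "N \<in> carrier_mat n n" using N by auto
  define e where "e i = 1 / sqrt (g i)" for i
  \<comment> \<open>\<open>?E\<close> is the scaling and \<open>?F\<close> its inverse, the witness
    that the scaling is a congruence.\<close>
  let ?E = "mat_diag n (\<lambda>i. complex_of_real (e i))"
  let ?F = "mat_diag n (\<lambda>i. complex_of_real (sqrt (g i)))"
  have e_sq: "e i * e i = 1 / g i" "sqrt (g i) * e i = 1" if "i < n" for i
    using g[OF that] by (simp_all add: e_def)
  have "?F * ?E = mat_diag n (\<lambda>_. 1)"
    unfolding mat_diag_diag using e_sq(2) by (auto simp: mat_diag_def simp flip: of_real_mult)
  hence "?F * ?E = 1\<^sub>m n" unfolding mat_diag_one .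
  hence "hpd_mat n (mat_adjoint ?E * N * ?E)"
    by (intro hpd_mat_congruence[OF N, of ?E ?F]) simp_all
  hence hpd: "hpd_mat n (?E * N * ?E)" unfolding mat_adjoint_diag_real .
  have "Re ((?E * N * ?E) $$ (i, i)) = Re (N $$ (i, i)) / g i" if "i < n" for i
  proof -
    have "Re ((?E * N * ?E) $$ (i, i)) = Re (N $$ (i, i)) * (e i * e i)"
      using that by (simp add: mat_diag_mult_left[OF Nc] mat_diag_mult_right[of _ n n])
    thus ?thesis by (simp add: e_sq that)
  qed
  hence "Re (det (?E * N * ?E)) \<le> 1"
    using le g by (intro det_hpd_mat_le_one[OF hpd]) simp
  moreover have "det (?E * N * ?E) = complex_of_real (\<Prod>i<n. e i * e i) * det N"
    by (simp add: det_mult[of _ n] det_mat_diag prod.distrib)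
  moreover have "(\<Prod>i<n. e i * e i) = 1 / (\<Prod>i<n. g i)"
    by (simp add: e_sq prod_dividef)
  ultimately have "Re (det N) / (\<Prod>i<n. g i) \<le> 1"
    by (simp del: of_real_prod)
  moreover have "(\<Prod>i<n. g i) > 0" using g by (intro prod_pos) auto
  ultimately show ?thesis by simp
qed

section \<open>The determinant of a mean of powers\<close>

text \<open>The inequality \<open>1 + s \<le> exp s\<close> at \<open>s = (1 - t) ln (x / m)\<close> and at \<open>s = - t ln (x / m)\<close>,
  averaged with weights \<open>t\<close> and \<open>1 - t\<close>.\<close>

lemma powr_le_tangent:
  fixes x m t :: real
  assumes "0 < x" "0 < m" "0 \<le> t" "t \<le> 1"
  shows "x powr t \<le> m powr t + t * m powr (t - 1) * (x - m)"
proof -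
  define a where "a = ln (x / m)"
  have xm: "exp a = x / m" using assms by (simp add: a_def)
  have "t * (1 + (a - t * a)) \<le> t * exp (a - t * a)" "(1 - t) * (1 + (- (t * a))) \<le> (1 - t) * exp (- (t * a))"
    using assms by (intro mult_left_mono exp_ge_add_one_self; simp)+
  hence "1 \<le> t * exp (a - t * a) + (1 - t) * exp (- (t * a))"
    by (simp add: algebra_simps)
  also have "\<dots> = (t * exp a + (1 - t)) / exp (t * a)"
    by (simp add: exp_diff exp_minus field_simps)
  finally have "exp (t * a) \<le> t * (x / m) + (1 - t)"
    by (simp add: xm)
  hence "m powr t * exp (t * a) \<le> m powr t * (t * (x / m) + (1 - t))"
    by (intro mult_left_mono) auto
  also have "m powr t * exp (t * a) = x powr t"
    using assms by (simp add: a_def powr_def ln_div exp_add[symmetric] algebra_simps)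
  also have "m powr t * (t * (x / m) + (1 - t)) = m powr t + t * m powr (t - 1) * (x - m)"
    using assms by (simp add: powr_diff field_simps)
  finally show ?thesis .
qed

text \<open>In the basis \<open>U\<close>, the diagonal entries of \<open>P\<close> and of its power
  average \<open>d j\<close> and \<open>d j powr t\<close> with the same weights. The tangent is
  affine, so it passes through the average. The point \<open>m\<close> is free, so one tangent can
  serve two matrices.\<close>

lemma mat_powr_diag_entry_le:
  assumes P: "hpd_mat n P" and U: "unitary_mat n U" and i: "i < n"
    and m: "0 < m" and t: "0 \<le> t" "t \<le> 1"
  shows "Re ((mat_adjoint U * mat_powr P t * U) $$ (i, i))
    \<le> m powr t + t * m powr (t - 1) * (Re ((mat_adjoint U * P * U) $$ (i, i)) - m)"
proof -
  obtain V d where V: "unitary_mat n V" and d: "\<And>i. i < n \<Longrightarrow> 0 < d i"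
    and PV: "P = V * mat_diag n (\<lambda>i. complex_of_real (d i)) * mat_adjoint V"
    using hpd_mat_spectral[OF P] by metis
  have [simp]: "U \<in> carrier_mat n n" "V \<in> carrier_mat n n" using U V by auto
  define W where "W = mat_adjoint U * V"
  have W: "unitary_mat n W" using unitary_mat_mult[OF unitary_mat_adjoint[OF U] V] by (simp add: W_def)
  have W_conj: "mat_adjoint U * (V * M * mat_adjoint V) * U = W * M * mat_adjoint W"
    if "M \<in> carrier_mat n n" for M
    using that by (simp add: W_def mat_adjoint_mult[of _ n n _ n] assoc_mult_mat[of _ n n _ n _ n])
  let ?w = "\<lambda>j. (cmod (W $$ (i, j)))\<^sup>2"
  have "(\<Sum>j<n. ?w j * d j powr t)
      \<le> (\<Sum>j<n. ?w j * (m powr t + t * m powr (t - 1) * (d j - m)))"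
    using d m t by (intro sum_mono mult_left_mono powr_le_tangent) auto
  \<comment> \<open>Separates the constant part of the tangent, where the weights sum to 1, from the
    part linear in \<open>d j\<close>.\<close>
  also have "\<dots> = (\<Sum>j<n. ?w j * (m powr t - t * m powr (t - 1) * m) + t * m powr (t - 1) * (?w j * d j))"
    by (intro sum.cong) (simp_all add: algebra_simps)
  also have "\<dots> = (\<Sum>j<n. ?w j) * (m powr t - t * m powr (t - 1) * m)
      + t * m powr (t - 1) * (\<Sum>j<n. ?w j * d j)"
    by (simp only: sum.distrib sum_distrib_left sum_distrib_right)
  also have "\<dots> = m powr t + t * m powr (t - 1) * ((\<Sum>j<n. ?w j * d j) - m)"
    by (simp add: unitary_row_sum[OF W i] algebra_simps)
  finally have "(\<Sum>j<n. ?w j * d j powr t)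
      \<le> m powr t + t * m powr (t - 1) * ((\<Sum>j<n. ?w j * d j) - m)" .
  moreover have "mat_powr P t = V * mat_diag n (\<lambda>i. complex_of_real (d i powr t)) * mat_adjoint V"
    unfolding PV by (rule mat_powr_spectral[OF V d])
  ultimately show ?thesis
    unfolding PV
    by (simp add: W_conj unitary_diag_entry[OF W i])
qed

theorem det_mean_mat_powr_le:
  assumes P: "hpd_mat n P" and Q: "hpd_mat n Q" and t: "0 \<le> t" "t \<le> 1"
  shows "Re (det ((1/2) \<cdot>\<^sub>m (mat_powr P t + mat_powr Q t)))
    \<le> Re (det ((1/2) \<cdot>\<^sub>m (P + Q))) powr t"
proof -
  define M where "M = (1/2) \<cdot>\<^sub>m (P + Q)"
  define N where "N = (1/2) \<cdot>\<^sub>m (mat_powr P t + mat_powr Q t)"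
  have M: "hpd_mat n M" unfolding M_def by (intro hpd_mat_half_add P Q)
  have N: "hpd_mat n N" unfolding N_def by (intro hpd_mat_half_add hpd_mat_powr P Q)
  have [simp]: "P \<in> carrier_mat n n" "Q \<in> carrier_mat n n" "mat_powr P t \<in> carrier_mat n n"
    "mat_powr Q t \<in> carrier_mat n n" "N \<in> carrier_mat n n"
    using P Q N hpd_mat_powr[OF P] hpd_mat_powr[OF Q] by auto
  \<comment> \<open>The eigenbasis of the mean is chosen so that the right-hand side becomes the
    product of the \<open>m i powr t\<close>.\<close>
  obtain U m where U: "unitary_mat n U" and m: "\<And>i. i < n \<Longrightarrow> 0 < m i"
    and MU: "M = U * mat_diag n (\<lambda>i. complex_of_real (m i)) * mat_adjoint U"
    using hpd_mat_spectral[OF M] by metis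
  have Uc [simp]: "U \<in> carrier_mat n n" using U by auto
  have mean: "(mat_adjoint U * ((1/2) \<cdot>\<^sub>m (X + Y)) * U) $$ (i, i)
      = ((mat_adjoint U * X * U) $$ (i, i) + (mat_adjoint U * Y * U) $$ (i, i)) / 2"
    if "X \<in> carrier_mat n n" "Y \<in> carrier_mat n n" "i < n" for X Y :: "complex mat" and i
  proof -
    have "mat_adjoint U * ((1/2) \<cdot>\<^sub>m (X + Y)) * U
        = (1/2) \<cdot>\<^sub>m (mat_adjoint U * X * U + mat_adjoint U * Y * U)"
      using that by (simp add: mult_smult_distrib[of _ n n _ n] mult_smult_assoc_mat[of _ n n _ n]
        mult_add_distrib_mat[of _ n n _ n] add_mult_distrib_mat[of _ n n _ _ n])
    thus ?thesis using that Uc carrier_matD[OF Uc] by simp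
  qed
  have diagM: "(mat_adjoint U * M * U) $$ (i, i) = m i" if "i < n" for i
    using unitary_conj_swap[OF unitary_mat_adjoint[OF U], of "mat_diag n (\<lambda>i. complex_of_real (m i))" M] MU that
    by (simp add: mat_diag_def)
  have "Re ((mat_adjoint U * N * U) $$ (i, i)) \<le> m i powr t" if i: "i < n" for i
  proof -
    let ?e = "\<lambda>X. Re ((mat_adjoint U * X * U) $$ (i, i))"
    let ?c = "t * m i powr (t - 1)"
    have "?e M = (?e P + ?e Q) / 2" unfolding M_def using i by (subst mean) auto
    \<comment> \<open>Both tangents at \<open>m i\<close> have slope \<open>?c\<close>; their linear
      terms cancel because \<open>m i\<close> is the mean of the two diagonal entries.\<close>
    hence PQ: "?e P + ?e Q - 2 * m i = 0" using diagM[OF i] by simp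
    have "2 * ?e N = ?e (mat_powr P t) + ?e (mat_powr Q t)"
      unfolding N_def using i by (subst mean) auto
    also have "\<dots> \<le> (m i powr t + ?c * (?e P - m i)) + (m i powr t + ?c * (?e Q - m i))"
      by (intro add_mono mat_powr_diag_entry_le[of n] P Q U i m t)
    also have "\<dots> = 2 * m i powr t + ?c * (?e P + ?e Q - 2 * m i)"
      by (simp add: algebra_simps)
    finally show ?thesis unfolding PQ by simp
  qed
  moreover have "hpd_mat n (mat_adjoint U * N * U)"
    using hpd_mat_congruence[OF N Uc, of "mat_adjoint U"] U by (simp add: unitary_mat_def)
  ultimately have "Re (det (mat_adjoint U * N * U)) \<le> (\<Prod>i<n. m i powr t)"
    using m by (intro hadamard_hpd_mat) (simp_all add: less_imp_neq[symmetric])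
  also have "\<dots> = (\<Prod>i<n. m i) powr t"
    using m by (simp add: prod_powr_distrib less_imp_le)
  also have "(\<Prod>i<n. m i) = Re (det M)"
    unfolding MU det_spectral[OF U] by (simp del: of_real_prod)
  finally show ?thesis
    using U by (simp add: det_unitary_conj M_def N_def[symmetric])
qed

section \<open>The S-divergence and the geometric mean\<close>

text \<open>Both terms of the divergence gain \<open>2 * ln z\<close>, with \<open>z\<close> the
  determinant of \<open>Z\<close>, and the gains cancel.\<close>

lemma S_div_sq_congruence:
  assumes Z: "hpd_mat n Z" and P: "hpd_mat n P" and Q: "hpd_mat n Q"
  shows "S_div_sq (Z * P * Z) (Z * Q * Z) = S_div_sq P Q"
proof -
  note hpd = Z P Q hpd_mat_half_add[OF P Q]
  have [simp]: "Z \<in> carrier_mat n n" "P \<in> carrier_mat n n" "Q \<in> carrier_mat n n" using hpd by auto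
  define z p q h where "z = Re (det Z)" and "p = Re (det P)" and "q = Re (det Q)"
    and "h = Re (det ((1/2) \<cdot>\<^sub>m (P + Q)))"
  have det: "det Z = z" "det P = p" "det Q = q" "det ((1/2) \<cdot>\<^sub>m (P + Q)) = h"
    and pos: "0 < z" "0 < p" "0 < q" "0 < h"
    using hpd[THEN det_hpd_mat(1)] hpd[THEN det_hpd_mat(2)] by (simp_all add: z_def p_def q_def h_def)
  \<comment> \<open>Keeps the factor 1/2 inside the determinant, so that the equation for
    \<open>h\<close> applies.\<close>
  note det_smult [simp del]
  have "(1/2) \<cdot>\<^sub>m (Z * P * Z + Z * Q * Z) = Z * ((1/2) \<cdot>\<^sub>m (P + Q)) * Z"
    by (simp add: mult_smult_distrib[of _ n n _ n] mult_smult_assoc_mat[of _ n n _ n]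
        mult_add_distrib_mat[of _ n n _ n] add_mult_distrib_mat[of _ n n _ _ n])
  hence "det ((1/2) \<cdot>\<^sub>m (Z * P * Z + Z * Q * Z)) = complex_of_real (z * h * z)"
    by (simp add: det_mult[of _ n] det)
  moreover have "det (Z * P * Z * (Z * Q * Z)) = complex_of_real (z * p * z * (z * q * z))"
    by (simp add: det_mult[of _ n] det)
  moreover have "det (P * Q) = complex_of_real (p * q)"
    by (simp add: det_mult[of _ n] det)
  ultimately show ?thesis
    using pos by (simp add: S_div_sq_def det ln_mult field_simps)
qed

text \<open>The determinant of a power is the power of the determinant, so the second term scales
  exactly by \<open>t\<close>; the inequality comes from the first term alone.\<close>

lemma S_div_sq_mat_powr_le:
  assumes P: "hpd_mat n P" and Q: "hpd_mat n Q" and t: "0 \<le> t" "t \<le> 1"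
  shows "S_div_sq (mat_powr P t) (mat_powr Q t) \<le> t * S_div_sq P Q"
proof -
  note pos = det_hpd_mat(1)
  let ?h = "\<lambda>X Y. Re (det ((1/2) \<cdot>\<^sub>m (X + Y)))"
  have "ln (?h (mat_powr P t) (mat_powr Q t)) \<le> ln (?h P Q powr t)"
    using det_mean_mat_powr_le[OF assms] pos[OF hpd_mat_half_add[OF hpd_mat_powr[OF P] hpd_mat_powr[OF Q]]]
    by (intro ln_mono)
  also have "\<dots> = t * ln (?h P Q)"
    by (simp add: ln_powr)
  finally show ?thesis
    using pos[OF P] pos[OF Q]
    by (simp add: S_div_sq_def Re_det_mult[OF hpd_mat_powr[OF P] hpd_mat_powr[OF Q]] Re_det_mult[OF P Q]
        Re_det_mat_powr[OF P] Re_det_mat_powr[OF Q] ln_mult ln_powr algebra_simps)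
qed

theorem theorem4p7:
  fixes n :: nat and A B C :: "complex mat" and t :: real
  assumes "hpd_mat n A" and "hpd_mat n B" and "hpd_mat n C"
    and "t \<in> {0..1}"
  shows "S_div_sq (geo_mean t A B) (geo_mean t A C) \<le> t * S_div_sq B C"
proof -
  define Z where "Z = mat_powr A (1/2)"
  define T where "T = mat_powr A (-1/2)"
  have Z: "hpd_mat n Z" and T: "hpd_mat n T"
    unfolding Z_def T_def by (intro hpd_mat_powr assms)+
  have [simp]: "Z \<in> carrier_mat n n" "T \<in> carrier_mat n n" using Z T by auto
  have ZT: "Z * T = 1\<^sub>m n" and TZ: "T * Z = 1\<^sub>m n"
    by (simp_all add: Z_def T_def mat_powr_mult[OF assms(1)] mat_powr_zero[OF assms(1)])
  \<comment> \<open>\<open>T\<close> is Hermitian with inverse \<open>Z\<close>, so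
    \<open>T * X * T\<close> is a congruence of \<open>X\<close>.\<close>
  have hpd: "hpd_mat n (T * X * T)" if "hpd_mat n X" for X
    using hpd_mat_congruence[OF that, of T Z] T ZT by (simp add: hpd_mat_def)
  have ZTX: "Z * (T * X * T) * Z = X" if "hpd_mat n X" for X
  proof -
    have [simp]: "X \<in> carrier_mat n n" using that by auto
    have "Z * (T * X * T) * Z = (Z * T) * X * (T * Z)"
      by (simp add: assoc_mult_mat[of _ n n _ n _ n])
    thus ?thesis by (simp add: ZT TZ one_mult_square_mat[of _ n])
  qed
  let ?P = "T * B * T" and ?Q = "T * C * T"
  \<comment> \<open>Both geometric means have the outer factors \<open>Z\<close>, which congruence
    invariance removes.\<close>
  have "S_div_sq (geo_mean t A B) (geo_mean t A C) = S_div_sq (mat_powr ?P t) (mat_powr ?Q t)"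
    unfolding geo_mean_def Z_def[symmetric] T_def[symmetric]
    by (intro S_div_sq_congruence[of n] Z hpd_mat_powr hpd assms)
  also have "\<dots> \<le> t * S_div_sq ?P ?Q"
    using assms(4) by (intro S_div_sq_mat_powr_le[of n] hpd assms) auto
  \<comment> \<open>Congruence by \<open>Z\<close> undoes the one by \<open>T\<close> and leads back
    to \<open>B\<close> and \<open>C\<close>.\<close>
  also have "S_div_sq ?P ?Q = S_div_sq B C"
    using S_div_sq_congruence[OF Z hpd[OF assms(2)] hpd[OF assms(3)]]
    by (simp add: ZTX[OF assms(2)] ZTX[OF assms(3)])
  finally show ?thesis .
qed

end
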